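(* Let $\alpha$ be a nonzero integer and let $(h_n)$ be the sequence with $h_0=0$, $h_1=1$, $h_2=-\alpha$, $h_3=-\alpha^3$, $h_4=0$, and for $m\ge2$: $h_{2m+1}=h_{m+2}h_m^3-h_{m-1}h_{m+1}^3$, for $m\ge 3$: $h_{2m}=h_m\big(h_{m+2}h_{m-1}^2-h_{m-2}h_{m+1}^2\big)/h_2$. (i) $h_n$ is a square for all positive integers $n$ not divisible by $4$ if and only if $\alpha$ is a square. (ii) $h_n$ is a cube for all positive integers $n$ not divisible by $4$ if and only if $\alpha$ is a cube.
   Context: The sequence defined is the elliptic divisibility sequence attached to the point $(0,0)$ of order $4$ on $y^2+xy-\alpha y=x^3-\alpha x^2$; $h_n=0$ exactly when $4\mid n$. Convention: an integer $m$ is called a square if $m=\pm\beta^2$ for some nonzero integer $\beta$, and a cube if $m=\beta^3$ for some nonzero integer $\beta$. *)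

theory Defs
  imports Complex_Main
begin

text \<open>
  Both notions exclude \<open>0\<close>, and a square is only required to be one up to sign;
  so they differ from the usual meaning of \<open>square\<close> and \<open>cube\<close> in the integers.
\<close>

definition signed_square :: "int \<Rightarrow> bool" where
  "signed_square m \<longleftrightarrow> (\<exists>\<beta>::int. \<beta> \<noteq> 0 \<and> (m = \<beta>^2 \<or> m = - (\<beta>^2)))"

definition nonzero_cube :: "int \<Rightarrow> bool" where
  "nonzero_cube m \<longleftrightarrow> (\<exists>\<beta>::int. \<beta> \<noteq> 0 \<and> m = \<beta>^3)"

end

theory Submission
  imports Defs
begin

text \<open>
  The doubling formulas determine the sequence from its first five terms. They are satisfied by
  \<open>\<plusminus> \<alpha> ^ \<lfloor>3 n\<^sup>2 / 8\<rfloor>\<close>, replaced by \<open>0\<close> where \<open>4\<close> divides \<open>n\<close>: at least one of the two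
  products in each formula vanishes, and in a nonzero one the exponents add up. So the nonzero
  terms are squares (cubes) if \<open>\<alpha>\<close> is, and \<open>h 2 = - \<alpha>\<close> yields the converse.
\<close>

definition elliptic_recurrence :: "(nat \<Rightarrow> 'a::field) \<Rightarrow> bool" where
  "elliptic_recurrence h \<longleftrightarrow>
     (\<forall>m\<ge>2. h (2 * m + 1) = h (m + 2) * h m ^ 3 - h (m - 1) * h (m + 1) ^ 3) \<and>
     (\<forall>m\<ge>3. h (2 * m) = h m * (h (m + 2) * h (m - 1) ^ 2 - h (m - 2) * h (m + 1) ^ 2) / h 2)"

lemma elliptic_recurrence_unique:
  assumes g: "elliptic_recurrence g" and h: "elliptic_recurrence h"
    and initial_eq: "\<And>i. i \<le> 4 \<Longrightarrow> g i = h i"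
  shows "g n = h n"
proof (induction n rule: less_induct)
  case (less n)
  have "n \<le> 4 \<or> (\<exists>m\<ge>2. n = 2 * m + 1) \<or> (\<exists>m\<ge>3. n = 2 * m)"
    by presburger
  then consider (initial) "n \<le> 4" | (odd) m where "m \<ge> 2" "n = 2 * m + 1"
    | (even) m where "m \<ge> 3" "n = 2 * m"
    by blast
  then show ?case
  proof cases
    case initial
    then show ?thesis by (rule initial_eq)
  next
    case (odd m)
    then have "g i = h i" if "i \<in> {m - 1, m, m + 1, m + 2}" for i
      using that by (intro less) auto
    then show ?thesis
      using odd g h by (simp add: elliptic_recurrence_def)
  next
    case (even m)
    then have "g i = h i" if "i \<in> {2, m - 2, m - 1, m, m + 1, m + 2}" for i
      using that by (intro less) auto
    then show ?thesis
      using even g h by (simp add: elliptic_recurrence_def)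
  qed
qed

definition order4_sign :: "nat \<Rightarrow> int" where
  "order4_sign n = (if 4 dvd n then 0 else if n mod 4 = 1 \<or> n mod 8 = 6 then 1 else - 1)"

definition order4_eds :: "'a::comm_ring_1 \<Rightarrow> nat \<Rightarrow> 'a" where
  "order4_eds a n = of_int (order4_sign n) * a ^ (3 * n\<^sup>2 div 8)"

lemma order4_sign_not_dvd: "\<not> 4 dvd n \<Longrightarrow> order4_sign n = 1 \<or> order4_sign n = - 1"
  by (simp add: order4_sign_def)

lemma order4_sign_4_mult_plus:
  "order4_sign (4 * k) = 0"
  "order4_sign (4 * k + 1) = 1"
  "order4_sign (4 * k + 2) = (if even k then - 1 else 1)"
  "order4_sign (4 * k + 3) = - 1"
  unfolding order4_sign_def by presburger+

lemma three_mult_square_div_8: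
  fixes k r :: nat
  shows "3 * (4 * k + r)\<^sup>2 div 8 = 6 * k\<^sup>2 + 3 * r * k + 3 * r\<^sup>2 div 8"
proof -
  have "3 * (4 * k + r)\<^sup>2 = 8 * (6 * k\<^sup>2 + 3 * r * k) + 3 * r\<^sup>2"
    by (simp add: power2_eq_square algebra_simps)
  then show ?thesis
    by simp
qed

lemma order4_eds_4_mult_plus:
  "order4_eds a (4 * k) = 0"
  "order4_eds a (4 * k + 1) = a ^ (6 * k\<^sup>2 + 3 * k)"
  "order4_eds a (4 * k + 2) = - ((- 1) ^ k * a ^ (6 * k\<^sup>2 + 6 * k + 1))"
  "order4_eds a (4 * k + 3) = - (a ^ (6 * k\<^sup>2 + 9 * k + 3))"
  by (simp_all only: order4_eds_def order4_sign_4_mult_plus three_mult_square_div_8) simp_all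

lemma nat_mod_4_cases:
  fixes n :: nat
  obtains (zero) k where "n = 4 * k" | (one) k where "n = 4 * k + 1"
    | (two) k where "n = 4 * k + 2" | (three) k where "n = 4 * k + 3"
proof -
  have "\<exists>k. n = 4 * k \<or> n = 4 * k + 1 \<or> n = 4 * k + 2 \<or> n = 4 * k + 3"
    by presburger
  then show thesis using that by blast
qed

lemma order4_eds_eq_0: "4 dvd n \<Longrightarrow> order4_eds a n = 0"
  by (simp add: order4_eds_def order4_sign_def)

lemma order4_eds_even_index_eq_0:
  assumes "even n"
  shows "order4_eds a n = 0 \<or> order4_eds a (n + 2) = 0"
proof -
  have "4 dvd n \<or> 4 dvd n + 2"
    using assms by presburger
  then show ?thesis
    using order4_eds_eq_0 by blast
qed

lemma order4_eds_double_plus_3_if_even: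
  assumes "even m"
  shows "order4_eds a (2 * m + 3) = order4_eds a (m + 3) * order4_eds a (m + 1) ^ 3"
proof (cases m rule: nat_mod_4_cases)
  case (zero k)
  have index_eqs: "2 * (4 * k) + 3 = 4 * (2 * k) + 3"
    by simp
  show ?thesis
    unfolding zero index_eqs order4_eds_4_mult_plus
    by (simp add: power2_eq_square algebra_simps flip: power_add power_mult)
next
  case (two k)
  have index_eqs: "2 * (4 * k + 2) + 3 = 4 * (2 * k + 1) + 3" "4 * k + 2 + 3 = 4 * (k + 1) + 1"
    "4 * k + 2 + 1 = 4 * k + 3"
    by simp_all
  show ?thesis
    unfolding two index_eqs order4_eds_4_mult_plus
    by (simp add: power2_eq_square algebra_simps flip: power_add power_mult)
qed (use assms in simp_all)

lemma order4_eds_double_plus_3_if_odd: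
  assumes "odd m"
  shows "order4_eds a (2 * m + 3) = - (order4_eds a m * order4_eds a (m + 2) ^ 3)"
proof (cases m rule: nat_mod_4_cases)
  case (one k)
  have index_eqs: "2 * (4 * k + 1) + 3 = 4 * (2 * k + 1) + 1" "4 * k + 1 + 2 = 4 * k + 3"
    by simp_all
  show ?thesis
    unfolding one index_eqs order4_eds_4_mult_plus
    by (simp add: power2_eq_square algebra_simps flip: power_add power_mult)
next
  case (three k)
  have index_eqs: "2 * (4 * k + 3) + 3 = 4 * (2 * k + 2) + 1"
    "4 * k + 3 + 2 = 4 * (k + 1) + 1"
    by simp_all
  show ?thesis
    unfolding three index_eqs order4_eds_4_mult_plus
    by (simp add: power2_eq_square algebra_simps flip: power_add power_mult)
qed (use assms in simp_all)

lemma order4_eds_odd_recurrence: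
  "order4_eds a (2 * m + 3) =
     order4_eds a (m + 3) * order4_eds a (m + 1) ^ 3 - order4_eds a m * order4_eds a (m + 2) ^ 3"
proof (cases "even m")
  case True
  then show ?thesis
    using order4_eds_even_index_eq_0[of m a] order4_eds_double_plus_3_if_even[of m a] by auto
next
  case False
  then have "order4_eds a (m + 1) = 0 \<or> order4_eds a (m + 1 + 2) = 0"
    by (intro order4_eds_even_index_eq_0) simp
  then have "order4_eds a (m + 3) * order4_eds a (m + 1) ^ 3 = 0"
    by (auto simp: numeral_3_eq_3)
  with False show ?thesis
    by (simp add: order4_eds_double_plus_3_if_odd)
qed

lemma order4_eds_2: "order4_eds a 2 = - a"
  by (simp add: order4_eds_def order4_sign_def)

lemma order4_eds_double_plus_4_if_mod_4_eq_1:
  assumes "m mod 4 = 1"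
  shows "order4_eds a (2 * m + 4) * order4_eds a 2 =
    order4_eds a (m + 2) * (order4_eds a (m + 4) * order4_eds a (m + 1) ^ 2)"
proof -
  obtain k where m: "m = 4 * k + 1"
    using assms by (metis mult_div_mod_eq)
  have index_eqs: "2 * (4 * k + 1) + 4 = 4 * (2 * k + 1) + 2" "4 * k + 1 + 4 = 4 * (k + 1) + 1"
    "4 * k + 1 + 2 = 4 * k + 3" "4 * k + 1 + 1 = 4 * k + 2"
    by simp_all
  show ?thesis
    unfolding m index_eqs order4_eds_2 order4_eds_4_mult_plus
    by (simp add: power2_eq_square algebra_simps flip: power_add power_mult power_Suc)
qed

lemma order4_eds_double_plus_4_if_mod_4_eq_3:
  assumes "m mod 4 = 3"
  shows "order4_eds a (2 * m + 4) * order4_eds a 2 =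
    - (order4_eds a (m + 2) * (order4_eds a m * order4_eds a (m + 3) ^ 2))"
proof -
  obtain k where m: "m = 4 * k + 3"
    using assms by (metis mult_div_mod_eq)
  have index_eqs: "2 * (4 * k + 3) + 4 = 4 * (2 * k + 2) + 2"
    "4 * k + 3 + 2 = 4 * (k + 1) + 1" "4 * k + 3 + 3 = 4 * (k + 1) + 2"
    by simp_all
  show ?thesis
    unfolding m index_eqs order4_eds_2 order4_eds_4_mult_plus
    by (simp add: power2_eq_square algebra_simps flip: power_add power_mult power_Suc)
qed

lemma order4_eds_even_recurrence:
  "order4_eds a (2 * m + 4) * order4_eds a 2 =
     order4_eds a (m + 2) *
       (order4_eds a (m + 4) * order4_eds a (m + 1) ^ 2 - order4_eds a m * order4_eds a (m + 3) ^ 2)"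
proof -
  have "4 dvd m \<or> 4 dvd m + 2 \<or> m mod 4 = 1 \<or> m mod 4 = 3"
    by presburger
  then consider (zero) "4 dvd m" | (two) "4 dvd m + 2" | (one) "m mod 4 = 1" | (three) "m mod 4 = 3"
    by blast
  then show ?thesis
  proof cases
    case zero
    then have "4 dvd 2 * m + 4" "4 dvd m + 4"
      by simp_all
    with zero show ?thesis
      by (simp add: order4_eds_eq_0)
  next
    case two
    then have "4 dvd 2 * m + 4"
      by presburger
    with two show ?thesis
      by (simp add: order4_eds_eq_0)
  next
    case one
    then have "4 dvd m + 3"
      by presburger
    with order4_eds_double_plus_4_if_mod_4_eq_1[OF one] show ?thesis
      by (simp add: order4_eds_eq_0)
  next
    case three
    then have "4 dvd m + 1"
      by presburger
    with order4_eds_double_plus_4_if_mod_4_eq_3[OF three] show ?thesis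
      by (simp add: order4_eds_eq_0)
  qed
qed

lemma elliptic_recurrence_order4_eds:
  fixes a :: "'a::field"
  assumes "a \<noteq> 0"
  shows "elliptic_recurrence (order4_eds a)"
  unfolding elliptic_recurrence_def
proof (intro conjI allI impI)
  fix m :: nat
  assume "m \<ge> 2"
  then have index_eqs: "2 * (m - 1) + 3 = 2 * m + 1" "m - 1 + 3 = m + 2" "m - 1 + 1 = m"
    "m - 1 + 2 = m + 1"
    by simp_all
  show "order4_eds a (2 * m + 1) =
      order4_eds a (m + 2) * order4_eds a m ^ 3 - order4_eds a (m - 1) * order4_eds a (m + 1) ^ 3"
    using order4_eds_odd_recurrence[of a "m - 1"] unfolding index_eqs .
next
  fix m :: nat
  assume "m \<ge> 3"
  then have index_eqs: "2 * (m - 2) + 4 = 2 * m" "m - 2 + 2 = m" "m - 2 + 4 = m + 2"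
    "m - 2 + 1 = m - 1" "m - 2 + 3 = m + 1"
    by simp_all
  have "order4_eds a 2 \<noteq> 0"
    using assms by (simp add: order4_eds_2)
  then show "order4_eds a (2 * m) = order4_eds a m *
      (order4_eds a (m + 2) * order4_eds a (m - 1) ^ 2
        - order4_eds a (m - 2) * order4_eds a (m + 1) ^ 2) / order4_eds a 2"
    using order4_eds_even_recurrence[of a "m - 2"] unfolding index_eqs
    by (rule nonzero_eq_divide_eq[THEN iffD2])
qed

lemma signed_square_uminus_iff: "signed_square (- x) \<longleftrightarrow> signed_square x"
proof -
  have "- x = y \<or> - x = - y \<longleftrightarrow> x = y \<or> x = - y" for y
    by auto
  then show ?thesis
    by (simp only: signed_square_def)
qed

lemma signed_square_power:
  assumes "signed_square x"
  shows "signed_square (x ^ e)"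
proof -
  obtain b where b: "b \<noteq> 0" "x = b\<^sup>2 \<or> x = - b\<^sup>2"
    using assms by (auto simp: signed_square_def)
  then have "x ^ e = (b ^ e)\<^sup>2 \<or> x ^ e = - (b ^ e)\<^sup>2"
    by (cases "even e") (auto simp: mult.commute simp flip: power_mult)
  with b(1) show ?thesis
    unfolding signed_square_def by (intro exI[of _ "b ^ e"]) simp
qed

lemma nonzero_cube_uminus_iff: "nonzero_cube (- x) \<longleftrightarrow> nonzero_cube x"
proof -
  have "nonzero_cube (- y)" if "nonzero_cube y" for y
  proof -
    obtain b where "b \<noteq> 0" "y = b ^ 3"
      using \<open>nonzero_cube y\<close> by (auto simp: nonzero_cube_def)
    then show ?thesis
      unfolding nonzero_cube_def by (intro exI[of _ "- b"]) simp
  qed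
  from this[of x] this[of "- x"] show ?thesis by auto
qed

lemma nonzero_cube_power:
  assumes "nonzero_cube x"
  shows "nonzero_cube (x ^ e)"
proof -
  obtain b where "b \<noteq> 0" "x = b ^ 3"
    using assms by (auto simp: nonzero_cube_def)
  then show ?thesis
    unfolding nonzero_cube_def
    by (intro exI[of _ "b ^ e"]) (simp add: mult.commute flip: power_mult)
qed

lemma order4_eds_terms_satisfy_iff:
  fixes x :: int and P :: "int \<Rightarrow> bool"
  assumes uminus: "\<And>y. P (- y) \<longleftrightarrow> P y" and power: "\<And>y e. P y \<Longrightarrow> P (y ^ e)"
  shows "(\<forall>n>0. \<not> 4 dvd n \<longrightarrow>
            (\<exists>k. order4_eds (of_int x :: 'a::{comm_ring_1,ring_char_0}) n = of_int k \<and> P k)) \<longleftrightarrow> P x"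
    (is "?all_terms \<longleftrightarrow> _")
proof
  assume ?all_terms
  moreover have "\<not> 4 dvd (2::nat)"
    by simp
  ultimately obtain k where "order4_eds (of_int x :: 'a) 2 = of_int k" "P k"
    by (meson zero_less_numeral)
  moreover from this have "k = - x"
    by (metis order4_eds_2 of_int_eq_iff of_int_minus)
  ultimately show "P x"
    using uminus by simp
next
  assume "P x"
  show ?all_terms
  proof (intro allI impI exI conjI)
    fix n :: nat
    assume "\<not> 4 dvd n"
    with \<open>P x\<close> show "P (order4_sign n * x ^ (3 * n\<^sup>2 div 8))"
      using order4_sign_not_dvd[of n] uminus power by auto
  qed (simp add: order4_eds_def)
qed

theorem theorem5p2:
  fixes \<alpha> :: int and h :: "nat \<Rightarrow> rat"
  assumes "\<alpha> \<noteq> 0"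
    and "h 0 = 0" and "h 1 = 1" and "h 2 = - of_int \<alpha>" and "h 3 = - (of_int \<alpha> ^ 3)" and "h 4 = 0"
    and "\<And>m. m \<ge> 2 \<Longrightarrow> h (2 * m + 1) = h (m + 2) * h m ^ 3 - h (m - 1) * h (m + 1) ^ 3"
    and "\<And>m. m \<ge> 3 \<Longrightarrow>
           h (2 * m) = h m * (h (m + 2) * h (m - 1) ^ 2 - h (m - 2) * h (m + 1) ^ 2) / h 2"
  shows "((\<forall>n>0. \<not> 4 dvd n \<longrightarrow> (\<exists>k::int. h n = of_int k \<and> signed_square k))
            \<longleftrightarrow> signed_square \<alpha>)
       \<and> ((\<forall>n>0. \<not> 4 dvd n \<longrightarrow> (\<exists>k::int. h n = of_int k \<and> nonzero_cube k))
            \<longleftrightarrow> nonzero_cube \<alpha>)"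
proof -
  have "h n = order4_eds (of_int \<alpha>) n" for n
  proof (rule elliptic_recurrence_unique)
    show "elliptic_recurrence h"
      using assms(7,8) by (simp add: elliptic_recurrence_def)
    show "elliptic_recurrence (order4_eds (of_int \<alpha> :: rat))"
      using assms(1) by (simp add: elliptic_recurrence_order4_eds)
    show "h i = order4_eds (of_int \<alpha>) i" if "i \<le> 4" for i
    proof -
      have "i \<in> {0, 1, 2, 3, 4}"
        using that by auto
      then show ?thesis
        using assms(2-6) by (auto simp: order4_eds_def order4_sign_def)
    qed
  qed
  then show ?thesis
    by (simp add: order4_eds_terms_satisfy_iff signed_square_uminus_iff signed_square_power
        nonzero_cube_uminus_iff nonzero_cube_power)
qed

end
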